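(* $\mathsf{nuB}\subseteq\mathsf{CB}(\mathbb R^{\mathrm{ns}})$: for every $\mathcal D\in\mathsf{nuB}$ there is $\mathcal D'\in\mathsf{CB}(\mathbb R^{\mathrm{ns}})$ with $[\![\mathcal D']\!]=[\![\mathcal D]\!]$.
   Context: $|x|$ is the binary length of $x\in\mathbb N$. $\mathbb R$ is the set of relations $r:\mathbb N^k\to\{0,1\}$ (any $k$) with $|\vec x|=|\vec y|\Rightarrow r(\vec x)=r(\vec y)$; $\mathbb R^{\mathrm{ns}}$ is the set of all two-sorted functions $r(\vec x;\vec y)$ (any split of the arguments of $r$ into normal $\vec x$ and safe $\vec y$) for $r(\vec x,\vec y)\in\mathbb R$. Types: $N$, $\Box N$; sequents $\Gamma\Rightarrow A$ with all $\Box N$ before all $N$. Rules of $\mathsf B^-$: $\mathsf{id}$: $N\Rightarrow N$; $\mathsf{cut}_N$: from $\Gamma\Rightarrow N$, $\Gamma,N\Rightarrow B$ infer $\Gamma\Rightarrow B$; $\mathsf{cut}_\Box$: from $\Gamma\Rightarrow\Box N$, $\Box N,\Gamma\Rightarrow B$ infer $\Gamma\Rightarrow B$; $\mathsf w_N,\mathsf w_\Box$ (weakening); exchange; $\Box_l$: from $\Gamma,N\Rightarrow A$ infer $\Box N,\Gamma\Rightarrow A$; $\Box_r$: from $\Box\Gamma\Rightarrow N$ infer $\Box\Gamma\Rightarrow\Box N$; $0,1$: $\Rightarrow N$; $\mathsf s_0,\mathsf s_1$: from $\Gamma\Rightarrow A$ infer $\Gamma\Rightarrow A$; $\mathsf{cond}_N$: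 from $\Gamma\Rightarrow N$, $\Gamma,N\Rightarrow N$, $\Gamma,N\Rightarrow N$ infer $\Gamma,N\Rightarrow N$; $\mathsf{cond}_\Box$: from $\Gamma\Rightarrow N$, $\Box N,\Gamma\Rightarrow N$, $\Box N,\Gamma\Rightarrow N$ infer $\Box N,\Gamma\Rightarrow N$; $|\mathsf{cond}|_N,|\mathsf{cond}|_\Box$: same with only the first two premises. A $\mathsf B^-(F)$-coderivation (for a set $F$ of two-sorted functions) is a possibly infinite finitely branching tree built from these rules and initial sequents $\Box N^m,N^n\Rightarrow N$ labelled by $g\in F$ with $m$ normal, $n$ safe arguments; $\mathsf B^-$-coderivations use none. Semantics (node with conclusion $\Box N^m,N^n\Rightarrow A$ denotes $f(x_1..x_m;y_1..y_n)$; $f_0,f_1,f_2$ for premises; $i\in\{0,1\}$, $2z+i\neq0$): $\mathsf{id}$: $f(;y)=y$; $\mathsf{cut}_N$: $f(\vec x;\vec y)=f_1(\vec x;\vec y,f_0(\vec x;\vec y))$; $\mathsf{cut}_\Box$: $f(\vec x;\vec y)=f_1(f_0(\vec x;\vec y),\vec x;\vec y)$; weakenings ignore the new argument; exchange permutes; $\Box_l$: $f(x,\vec x;\vec y)=f_0(\vec x;\vec y,x)$; $\Box_r$: $f(\vec x;)=f_0(\vec x;)$; $0,1$ constants; $\mathsf s_i$: $f=2f_0+i$; $\mathsf{cond}_N$: $f(\vec x;\vec y,0)=f_0(\vec x;\vec y)$, $f(\vec x;\vec y,2y+i)=f_{i+1}(\vec x;\vec y,y)$; $\mathsf{cond}_\Box$: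 $f(0,\vec x;\vec y)=f_0(\vec x;\vec y)$, $f(2x+i,\vec x;\vec y)=f_{i+1}(x,\vec x;\vec y)$; $|\mathsf{cond}|$ versions use $f_1$ for both $i$; initial sequent $g$: $f=g$. $[\![\mathcal D]\!]$ is the partial function computed by this equational program. Immediate ancestry: side-context occurrences in premises are immediate ancestors of same-position occurrences in the conclusion; in $\Box_l$ the displayed $N$ is ancestor of the displayed $\Box N$; in conditionals the displayed formula of non-leftmost premises is ancestor of the principal one. A thread is a maximal ancestry path; progressing if eventually constantly $\Box N$ and infinitely often principal for $\mathsf{cond}_\Box$ or $|\mathsf{cond}|_\Box$. A coderivation is progressing if each infinite branch has a progressing thread; safe if each branch crosses finitely many $\mathsf{cut}_\Box$; left-leaning if each branch goes right at $\mathsf{cut}_N$ finitely often; regular if it has finitely many distinct sub-coderivations; $\mathsf R$-regular if it has finitely many distinct sub-coderivations containing rules from the set $\mathsf R$. $\mathsf{CB}(F)$: regular progressing safe left-leaning $\mathsf B^-(F)$-coderivations. $\mathsf{nuB}$: $\{\mathsf{cond}_\Box,\mathsf{cond}_N,\mathsf s_0,\mathsf s_1,\mathsf{id}\}$-regular progressing safe left-leaning $\mathsf B^-$-coderivations. *)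

theory Defs
  imports "HOL-Library.Log_Nat"
begin

section \<open>Two-sorted functions\<close>

text \<open>
  A (possibly partial) two-sorted function \<open>f(x\<^sub>1,\<dots>,x\<^sub>m; y\<^sub>1,\<dots>,y\<^sub>n)\<close>: the numbers \<open>m\<close> and \<open>n\<close> of
  normal and safe arguments, and its values. Argument lists of any other lengths
  have value \<^const>\<open>None\<close>, so that equality of such objects is equality of two-sorted functions.
\<close>

datatype two_sorted =
  Two_Sorted (normal: nat) (safe: nat) (app: "nat list \<Rightarrow> nat list \<Rightarrow> nat option")

text \<open>
  \<open>(k, r)\<close> stands for the relation \<open>r : \<nat>\<^sup>k \<rightarrow> {0,1}\<close>; only arguments of length \<open>k\<close> matter.
  The binary length of \<open>x\<close> is \<^term>\<open>floorlog 2 x\<close>, and that of \<open>0\<close> is \<open>0\<close>.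
\<close>

definition length_relations :: "(nat \<times> (nat list \<Rightarrow> nat)) set" where
  "length_relations = {(k, r).
     (\<forall>xs. length xs = k \<longrightarrow> r xs \<in> {0, 1}) \<and>
     (\<forall>xs ys. length xs = k \<longrightarrow> length ys = k \<longrightarrow>
        map (floorlog 2) xs = map (floorlog 2) ys \<longrightarrow> r xs = r ys)}"

definition Rns :: "two_sorted set" where
  "Rns = {Two_Sorted m n (\<lambda>xs ys. if length xs = m \<and> length ys = n then Some (r (xs @ ys)) else None)
          | m n r. (m + n, r) \<in> length_relations}"


section \<open>Coderivations\<close>

datatype type = TyN | TyBox

text \<open>\<open>Seq m n A\<close> is the sequent \<open>\<box>N\<^sup>m, N\<^sup>n \<Rightarrow> A\<close>.\<close>

datatype sequent = Seq nat nat type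

text \<open>
  The argument \<open>k\<close> of the exchange rules is the (0-based) position, among the \<open>N\<close>s or the
  \<open>\<box>N\<close>s respectively, of the left one of the two adjacent formulas being exchanged.
\<close>

datatype rule =
    Id | CutN | CutB | WeakN | WeakB | ExN nat | ExB nat | BoxL | BoxR
  | Zero | One | S0 | S1 | CondN | CondB | LCondN | LCondB | Init two_sorted

codatatype coder = Node (concl: sequent) (last_rule: rule) (prems: "coder list")

text \<open>The premises \<open>Ss\<close> in \<open>inference F r Ss S\<close> are listed from left to right.\<close>

inductive inference :: "two_sorted set \<Rightarrow> rule \<Rightarrow> sequent list \<Rightarrow> sequent \<Rightarrow> bool"
  for F where
  "inference F Id [] (Seq 0 1 TyN)"
| "inference F CutN [Seq m n TyN, Seq m (Suc n) B] (Seq m n B)"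
| "inference F CutB [Seq m n TyBox, Seq (Suc m) n B] (Seq m n B)"
| "inference F WeakN [Seq m n B] (Seq m (Suc n) B)"
| "inference F WeakB [Seq m n B] (Seq (Suc m) n B)"
| "Suc k < n \<Longrightarrow> inference F (ExN k) [Seq m n B] (Seq m n B)"
| "Suc k < m \<Longrightarrow> inference F (ExB k) [Seq m n B] (Seq m n B)"
| "inference F BoxL [Seq m (Suc n) A] (Seq (Suc m) n A)"
| "inference F BoxR [Seq m 0 TyN] (Seq m 0 TyBox)"
| "inference F Zero [] (Seq 0 0 TyN)"
| "inference F One [] (Seq 0 0 TyN)"
| "inference F S0 [Seq m n A] (Seq m n A)"
| "inference F S1 [Seq m n A] (Seq m n A)"
| "inference F CondN [Seq m n TyN, Seq m (Suc n) TyN, Seq m (Suc n) TyN] (Seq m (Suc n) TyN)"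
| "inference F CondB [Seq m n TyN, Seq (Suc m) n TyN, Seq (Suc m) n TyN] (Seq (Suc m) n TyN)"
| "inference F LCondN [Seq m n TyN, Seq m (Suc n) TyN] (Seq m (Suc n) TyN)"
| "inference F LCondB [Seq m n TyN, Seq (Suc m) n TyN] (Seq (Suc m) n TyN)"
| "g \<in> F \<Longrightarrow> inference F (Init g) [] (Seq (normal g) (safe g) TyN)"

coinductive coderivation :: "two_sorted set \<Rightarrow> coder \<Rightarrow> bool" for F where
  "inference F r (map concl Ds) S \<Longrightarrow> \<forall>D \<in> set Ds. coderivation F D \<Longrightarrow>
   coderivation F (Node S r Ds)"

inductive_set subcoders :: "coder \<Rightarrow> coder set" for D where
  "D \<in> subcoders D"
| "E \<in> subcoders D \<Longrightarrow> E' \<in> set (prems E) \<Longrightarrow> E' \<in> subcoders D"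


section \<open>Semantics\<close>

text \<open>
  \<open>eval D xs ys z\<close>: the equation \<open>f\<^sub>D(xs; ys) = z\<close> is derivable (in the style of Herbrand,
  Goedel and Kleene) from the equations of all nodes of \<open>D\<close>; inner terms have to be evaluated
  to numerals.
\<close>

inductive eval :: "coder \<Rightarrow> nat list \<Rightarrow> nat list \<Rightarrow> nat \<Rightarrow> bool" where
  "eval (Node S Id []) [] [y] y"
| "eval D0 xs ys z \<Longrightarrow> eval D1 xs (ys @ [z]) w \<Longrightarrow> eval (Node S CutN [D0, D1]) xs ys w"
| "eval D0 xs ys z \<Longrightarrow> eval D1 (z # xs) ys w \<Longrightarrow> eval (Node S CutB [D0, D1]) xs ys w"
| "eval D0 xs ys z \<Longrightarrow> eval (Node S WeakN [D0]) xs (ys @ [y]) z"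
| "eval D0 xs ys z \<Longrightarrow> eval (Node S WeakB [D0]) (x # xs) ys z"
| "eval D0 xs (us @ b # a # vs) z \<Longrightarrow> length us = k \<Longrightarrow>
   eval (Node S (ExN k) [D0]) xs (us @ a # b # vs) z"
| "eval D0 (us @ b # a # vs) ys z \<Longrightarrow> length us = k \<Longrightarrow>
   eval (Node S (ExB k) [D0]) (us @ a # b # vs) ys z"
| "eval D0 xs (ys @ [x]) z \<Longrightarrow> eval (Node S BoxL [D0]) (x # xs) ys z"
| "eval D0 xs [] z \<Longrightarrow> eval (Node S BoxR [D0]) xs [] z"
| "eval (Node S Zero []) [] [] 0"
| "eval (Node S One []) [] [] 1"
| "eval D0 xs ys z \<Longrightarrow> eval (Node S S0 [D0]) xs ys (2 * z)"
| "eval D0 xs ys z \<Longrightarrow> eval (Node S S1 [D0]) xs ys (2 * z + 1)"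
| "eval D0 xs ys z \<Longrightarrow> eval (Node S CondN [D0, D1, D2]) xs (ys @ [0]) z"
| "eval D1 xs (ys @ [y]) z \<Longrightarrow> 2 * y \<noteq> 0 \<Longrightarrow>
   eval (Node S CondN [D0, D1, D2]) xs (ys @ [2 * y]) z"
| "eval D2 xs (ys @ [y]) z \<Longrightarrow> eval (Node S CondN [D0, D1, D2]) xs (ys @ [2 * y + 1]) z"
| "eval D0 xs ys z \<Longrightarrow> eval (Node S CondB [D0, D1, D2]) (0 # xs) ys z"
| "eval D1 (x # xs) ys z \<Longrightarrow> 2 * x \<noteq> 0 \<Longrightarrow>
   eval (Node S CondB [D0, D1, D2]) ((2 * x) # xs) ys z"
| "eval D2 (x # xs) ys z \<Longrightarrow> eval (Node S CondB [D0, D1, D2]) ((2 * x + 1) # xs) ys z"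
| "eval D0 xs ys z \<Longrightarrow> eval (Node S LCondN [D0, D1]) xs (ys @ [0]) z"
| "eval D1 xs (ys @ [y]) z \<Longrightarrow> i \<in> {0, 1} \<Longrightarrow> 2 * y + i \<noteq> 0 \<Longrightarrow>
   eval (Node S LCondN [D0, D1]) xs (ys @ [2 * y + i]) z"
| "eval D0 xs ys z \<Longrightarrow> eval (Node S LCondB [D0, D1]) (0 # xs) ys z"
| "eval D1 (x # xs) ys z \<Longrightarrow> i \<in> {0, 1} \<Longrightarrow> 2 * x + i \<noteq> 0 \<Longrightarrow>
   eval (Node S LCondB [D0, D1]) ((2 * x + i) # xs) ys z"
| "app g xs ys = Some z \<Longrightarrow> eval (Node S (Init g) []) xs ys z"

fun semantics :: "coder \<Rightarrow> two_sorted" where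
  "semantics (Node (Seq m n A) r Ds) = Two_Sorted m n
     (\<lambda>xs ys. if \<exists>z. eval (Node (Seq m n A) r Ds) xs ys z
              then Some (THE z. eval (Node (Seq m n A) r Ds) xs ys z) else None)"


section \<open>Threads and correctness criteria\<close>

text \<open>
  Occurrences of formulas in an antecedent: \<open>OccB i\<close> is the \<open>i\<close>-th \<open>\<box>N\<close> and \<open>OccN j\<close> the
  \<open>j\<close>-th \<open>N\<close>, counting from \<open>0\<close>. Succedents are not tracked: their ancestry is disjoint
  from that of antecedents and they are never principal for a conditional.
\<close>

datatype occ = OccB nat | OccN nat

fun occurs :: "occ \<Rightarrow> sequent \<Rightarrow> bool" where
  "occurs (OccB i) (Seq m n A) \<longleftrightarrow> i < m"
| "occurs (OccN j) (Seq m n A) \<longleftrightarrow> j < n"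

text \<open>
  \<open>ancestor r p S x x'\<close>: in an instance of \<open>r\<close> with conclusion \<open>S\<close>, the occurrence \<open>x'\<close> in the
  \<open>p\<close>-th premise (counting from \<open>0\<close>) is an immediate ancestor of the occurrence \<open>x\<close> in \<open>S\<close>.
  Recall that the principal formula is the first \<open>\<box>N\<close> or the last \<open>N\<close>.
\<close>

inductive ancestor :: "rule \<Rightarrow> nat \<Rightarrow> sequent \<Rightarrow> occ \<Rightarrow> occ \<Rightarrow> bool" where
  "occurs x S \<Longrightarrow> p < 2 \<Longrightarrow> ancestor CutN p S x x"
| "occurs x S \<Longrightarrow> ancestor CutB 0 S x x"
| "i < m \<Longrightarrow> ancestor CutB 1 (Seq m n A) (OccB i) (OccB (Suc i))"
| "j < n \<Longrightarrow> ancestor CutB 1 (Seq m n A) (OccN j) (OccN j)"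
| "occurs x (Seq m n A) \<Longrightarrow> ancestor WeakN 0 (Seq m (Suc n) A) x x"
| "i < m \<Longrightarrow> ancestor WeakB 0 (Seq (Suc m) n A) (OccB (Suc i)) (OccB i)"
| "j < n \<Longrightarrow> ancestor WeakB 0 (Seq (Suc m) n A) (OccN j) (OccN j)"
| "occurs x S \<Longrightarrow> x \<notin> {OccN k, OccN (Suc k)} \<Longrightarrow> ancestor (ExN k) 0 S x x"
| "ancestor (ExN k) 0 S (OccN k) (OccN (Suc k))"
| "ancestor (ExN k) 0 S (OccN (Suc k)) (OccN k)"
| "occurs x S \<Longrightarrow> x \<notin> {OccB k, OccB (Suc k)} \<Longrightarrow> ancestor (ExB k) 0 S x x"
| "ancestor (ExB k) 0 S (OccB k) (OccB (Suc k))"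
| "ancestor (ExB k) 0 S (OccB (Suc k)) (OccB k)"
| "ancestor BoxL 0 (Seq (Suc m) n A) (OccB 0) (OccN n)"
| "i < m \<Longrightarrow> ancestor BoxL 0 (Seq (Suc m) n A) (OccB (Suc i)) (OccB i)"
| "j < n \<Longrightarrow> ancestor BoxL 0 (Seq (Suc m) n A) (OccN j) (OccN j)"
| "occurs x S \<Longrightarrow> r \<in> {BoxR, S0, S1} \<Longrightarrow> ancestor r 0 S x x"
| "occurs x (Seq m n A) \<Longrightarrow> r \<in> {CondN, LCondN} \<Longrightarrow> ancestor r 0 (Seq m (Suc n) A) x x"
| "i < m \<Longrightarrow> r \<in> {CondB, LCondB} \<Longrightarrow> ancestor r 0 (Seq (Suc m) n A) (OccB (Suc i)) (OccB i)"
| "j < n \<Longrightarrow> r \<in> {CondB, LCondB} \<Longrightarrow> ancestor r 0 (Seq (Suc m) n A) (OccN j) (OccN j)"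
| "occurs x S \<Longrightarrow> r \<in> {CondN, LCondN, CondB, LCondB} \<Longrightarrow> p \<in> {1, 2} \<Longrightarrow> ancestor r p S x x"

text \<open>
  An infinite branch is given by the sub-coderivations \<open>b i\<close> it visits, together with the
  indices \<open>d i\<close> of the premises it chooses (the same sub-coderivation may occur as several
  premises of one node).
\<close>

definition branch :: "coder \<Rightarrow> (nat \<Rightarrow> coder) \<Rightarrow> (nat \<Rightarrow> nat) \<Rightarrow> bool" where
  "branch D b d \<longleftrightarrow> b 0 = D \<and>
     (\<forall>i. d i < length (prems (b i)) \<and> b (Suc i) = prems (b i) ! d i)"

text \<open>
  A thread \<open>t\<close> along an infinite branch starts at the \<open>s\<close>-th node, where it cannot be
  extended towards the root. Only infinite threads are considered, as finite ones cannot be progressing.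
\<close>

definition thread :: "(nat \<Rightarrow> coder) \<Rightarrow> (nat \<Rightarrow> nat) \<Rightarrow> nat \<Rightarrow> (nat \<Rightarrow> occ) \<Rightarrow> bool" where
  "thread b d s t \<longleftrightarrow>
     (\<forall>i\<ge>s. occurs (t i) (concl (b i)) \<and>
        ancestor (last_rule (b i)) (d i) (concl (b i)) (t i) (t (Suc i))) \<and>
     \<not> (\<exists>j x. s = Suc j \<and> occurs x (concl (b j)) \<and>
        ancestor (last_rule (b j)) (d j) (concl (b j)) x (t s))"

definition progressing_thread :: "(nat \<Rightarrow> coder) \<Rightarrow> nat \<Rightarrow> (nat \<Rightarrow> occ) \<Rightarrow> bool" where
  "progressing_thread b s t \<longleftrightarrow>
     (\<exists>k\<ge>s. \<forall>i\<ge>k. \<exists>j. t i = OccB j) \<and>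
     infinite {i. s \<le> i \<and> last_rule (b i) \<in> {CondB, LCondB} \<and> t i = OccB 0}"

definition progressing :: "coder \<Rightarrow> bool" where
  "progressing D \<longleftrightarrow>
     (\<forall>b d. branch D b d \<longrightarrow> (\<exists>s t. thread b d s t \<and> progressing_thread b s t))"

definition safe_coder :: "coder \<Rightarrow> bool" where
  "safe_coder D \<longleftrightarrow> (\<forall>b d. branch D b d \<longrightarrow> finite {i. last_rule (b i) = CutB})"

definition left_leaning :: "coder \<Rightarrow> bool" where
  "left_leaning D \<longleftrightarrow> (\<forall>b d. branch D b d \<longrightarrow> finite {i. last_rule (b i) = CutN \<and> d i = 1})"

definition regular :: "coder \<Rightarrow> bool" where
  "regular D \<longleftrightarrow> finite (subcoders D)"

text \<open>A sub-coderivation counts if it contains a rule from \<open>R\<close> at any of its nodes.\<close>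

definition rule_regular :: "rule set \<Rightarrow> coder \<Rightarrow> bool" where
  "rule_regular R D \<longleftrightarrow> finite {E \<in> subcoders D. \<exists>E' \<in> subcoders E. last_rule E' \<in> R}"

definition CB :: "two_sorted set \<Rightarrow> coder set" where
  "CB F = {D. coderivation F D \<and> regular D \<and> progressing D \<and> safe_coder D \<and> left_leaning D}"

definition nuB :: "coder set" where
  "nuB = {D. coderivation {} D \<and> rule_regular {CondB, CondN, S0, S1, Id} D \<and>
             progressing D \<and> safe_coder D \<and> left_leaning D}"

end

(* A coderivation without the rules CondB, CondN, S0, S1, Id only inspects the binary lengths of its
   inputs and can only output 0 or 1. Progressing coderivations are total, since an undefined value
   would yield an infinite branch along whose progressing thread the inputs decrease forever. So such
   a coderivation computes a function of Rns, and replacing all of them by initial sequents leaves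
   finitely many sub-coderivations, while the infinite branches of the result are all inherited. *)

theory Submission
  imports Defs
begin

section \<open>Evaluation\<close>

text \<open>The five excluded rules play two roles: \<open>CondN\<close> and \<open>CondB\<close>
  see the last digit of an argument, while \<open>Id\<close>, \<open>S0\<close> and
  \<open>S1\<close> are what can produce values other than 0 and 1. \<open>LCondN\<close> and
  \<open>LCondB\<close> may stay, because a zero test and halving act on binary lengths. The main
  obstacle is the sort of the conclusion. An initial sequent concludes \<open>TyN\<close>, but a
  part to be replaced may conclude \<open>TyBox\<close> with safe arguments present, which
  \<open>BoxR\<close> forbids. What helps is that such a part does not depend on its safe arguments.
  This again rests on totality: when they change, the left premise of a \<open>CutN\<close> must
  still have some value. Totality also turns preservation of values into equality of partial
  functions: values are only transported from the original to the pruned coderivation, and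
  determinism does the rest.\<close>

inductive_cases eval_cases:
  "eval (Node S Id Ds) xs ys z"
  "eval (Node S CutN Ds) xs ys z"
  "eval (Node S CutB Ds) xs ys z"
  "eval (Node S WeakN Ds) xs ys z"
  "eval (Node S WeakB Ds) xs ys z"
  "eval (Node S (ExN k) Ds) xs ys z"
  "eval (Node S (ExB k) Ds) xs ys z"
  "eval (Node S BoxL Ds) xs ys z"
  "eval (Node S BoxR Ds) xs ys z"
  "eval (Node S Zero Ds) xs ys z"
  "eval (Node S One Ds) xs ys z"
  "eval (Node S S0 Ds) xs ys z"
  "eval (Node S S1 Ds) xs ys z"
  "eval (Node S CondN Ds) xs ys z"
  "eval (Node S CondB Ds) xs ys z"
  "eval (Node S LCondN Ds) xs ys z"
  "eval (Node S LCondB Ds) xs ys z"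
  "eval (Node S (Init g) Ds) xs ys z"

lemma double_plus_bit_inject:
  fixes x y i j :: nat
  assumes "2 * x + i = 2 * y + j" "i = 0 \<or> i = Suc 0" "j = 0 \<or> j = Suc 0"
  shows "x = y"
  using assms by presburger

lemma eval_iffs:
  "eval (Node S CutN [D0, D1]) xs ys w \<longleftrightarrow> (\<exists>z. eval D0 xs ys z \<and> eval D1 xs (ys @ [z]) w)"
  "eval (Node S CutB [D0, D1]) xs ys w \<longleftrightarrow> (\<exists>z. eval D0 xs ys z \<and> eval D1 (z # xs) ys w)"
  "eval (Node S WeakN [D0]) xs (ys @ [y]) z \<longleftrightarrow> eval D0 xs ys z"
  "eval (Node S WeakB [D0]) (x # xs) ys z \<longleftrightarrow> eval D0 xs ys z"
  "eval (Node S BoxL [D0]) (x # xs) ys z \<longleftrightarrow> eval D0 xs (ys @ [x]) z"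
  "eval (Node S BoxR [D0]) xs [] z \<longleftrightarrow> eval D0 xs [] z"
  "eval (Node S S0 [D0]) xs ys w \<longleftrightarrow> (\<exists>z. w = 2 * z \<and> eval D0 xs ys z)"
  "eval (Node S S1 [D0]) xs ys w \<longleftrightarrow> (\<exists>z. w = 2 * z + 1 \<and> eval D0 xs ys z)"
  "eval (Node S CondN [D0, D1, D2]) xs (ys @ [0]) z \<longleftrightarrow> eval D0 xs ys z"
  "eval (Node S CondN [D0, D1, D2]) xs (ys @ [2 * y + 1]) z \<longleftrightarrow> eval D2 xs (ys @ [y]) z"
  "eval (Node S CondB [D0, D1, D2]) (0 # xs) ys z \<longleftrightarrow> eval D0 xs ys z"
  "eval (Node S CondB [D0, D1, D2]) ((2 * x + 1) # xs) ys z \<longleftrightarrow> eval D2 (x # xs) ys z"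
  "eval (Node S LCondN [D0, D1]) xs (ys @ [0]) z \<longleftrightarrow> eval D0 xs ys z"
  "eval (Node S LCondB [D0, D1]) (0 # xs) ys z \<longleftrightarrow> eval D0 xs ys z"
  apply (auto intro: eval.intros eval.intros(13,16,19)[simplified] elim!: eval_cases)
  by presburger+

text \<open>The side conditions separate the clauses: a principal argument \<open>0\<close> belongs
  to the leftmost premise even if it is written \<open>2 * y\<close>, and for exchange the length of
  \<open>us\<close> fixes where the list is split.\<close>

lemma eval_conditional_iffs:
  "length us = k \<Longrightarrow> eval (Node S (ExN k) [D0]) xs (us @ a # b # vs) z \<longleftrightarrow>
     eval D0 xs (us @ b # a # vs) z"
  "length us = k \<Longrightarrow> eval (Node S (ExB k) [D0]) (us @ a # b # vs) ys z \<longleftrightarrow>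
     eval D0 (us @ b # a # vs) ys z"
  "2 * y \<noteq> 0 \<Longrightarrow> eval (Node S CondN [D0, D1, D2]) xs (ys @ [2 * y]) z \<longleftrightarrow> eval D1 xs (ys @ [y]) z"
  "2 * x \<noteq> 0 \<Longrightarrow> eval (Node S CondB [D0, D1, D2]) ((2 * x) # xs) ys z \<longleftrightarrow> eval D1 (x # xs) ys z"
  "i \<in> {0, 1} \<Longrightarrow> 2 * y + i \<noteq> 0 \<Longrightarrow>
     eval (Node S LCondN [D0, D1]) xs (ys @ [2 * y + i]) z \<longleftrightarrow> eval D1 xs (ys @ [y]) z"
  "i \<in> {0, 1} \<Longrightarrow> 2 * x + i \<noteq> 0 \<Longrightarrow>
     eval (Node S LCondB [D0, D1]) ((2 * x + i) # xs) ys z \<longleftrightarrow> eval D1 (x # xs) ys z"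
  apply (auto intro: eval.intros eval.intros(21,23)[simplified] elim!: eval_cases dest: double_plus_bit_inject)
  by presburger+

text \<open>Rule and arguments determine the clause that applies: zero, nonzero even and odd numbers
  exclude each other, and half and last digit are unique.\<close>

lemma eval_deterministic:
  "eval D xs ys z \<Longrightarrow> eval D xs ys w \<Longrightarrow> w = z"
proof (induction arbitrary: w rule: eval.induct)
  case (1 S y)
  then show ?case by (auto elim: eval_cases)
next
  case (10 S)
  then show ?case by (auto elim: eval_cases)
next
  case (11 S)
  then show ?case by (auto elim: eval_cases)
next
  case (24 g xs ys z S)
  then show ?case by (auto elim: eval_cases)
next
  case (6 D0 xs us b a vs z k S)
  then show ?case
    using eval_conditional_iffs(1) by (metis (lifting))
next
  case (7 D0 us b a vs ys z k S)
  then show ?case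
    using eval_conditional_iffs(2) by (metis (lifting))
next
  case (15 D1 xs ys y z S D0 D2)
  then show ?case
    using eval_conditional_iffs(3) by (metis (lifting))
next
  case (18 D1 x xs ys z S D0 D2)
  then show ?case
    using eval_conditional_iffs(4) by (metis (lifting))
next
  case (21 D1 xs ys y z i S D0)
  then show ?case
    using eval_conditional_iffs(5) by (metis (lifting))
next
  case (23 D1 x xs ys z i S D0)
  then show ?case
    using eval_conditional_iffs(6) by (metis (lifting))
qed ((simp (no_asm_use) only: eval_iffs)?, blast)+

lemma inference_mono: "inference F r Ss S \<Longrightarrow> F \<subseteq> G \<Longrightarrow> inference G r Ss S"
  by (induction rule: inference.induct) (auto intro: inference.intros[unfolded One_nat_def])

lemma coderivation_prems:
  "coderivation F D \<Longrightarrow> E \<in> set (prems D) \<Longrightarrow> coderivation F E"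
  by (auto elim: coderivation.cases)

section \<open>Arities of arguments\<close>

fun fits :: "nat list \<Rightarrow> nat list \<Rightarrow> sequent \<Rightarrow> bool" where
  "fits xs ys (Seq m n A) \<longleftrightarrow> length xs = m \<and> length ys = n"

inductive_cases inference_cases:
  "inference F Id Ss S"
  "inference F CutN Ss S"
  "inference F CutB Ss S"
  "inference F WeakN Ss S"
  "inference F WeakB Ss S"
  "inference F (ExN k) Ss S"
  "inference F (ExB k) Ss S"
  "inference F BoxL Ss S"
  "inference F BoxR Ss S"
  "inference F Zero Ss S"
  "inference F One Ss S"
  "inference F S0 Ss S"
  "inference F S1 Ss S"
  "inference F CondN Ss S"
  "inference F CondB Ss S"
  "inference F LCondN Ss S"
  "inference F LCondB Ss S"
  "inference F (Init g) Ss S"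

lemma coderivation_Node:
  "coderivation F (Node S r Ds) \<longleftrightarrow>
     inference F r (map concl Ds) S \<and> (\<forall>D \<in> set Ds. coderivation F D)"
  by (subst coderivation.simps) auto

text \<open>Evaluation does not check arities, but every rule respects them. Without initial
  sequents there is no \<open>g\<close> that could have values on lists of other lengths.\<close>

lemma eval_fits:
  "eval D xs ys z \<Longrightarrow> coderivation {} D \<Longrightarrow> fits xs ys (concl D)"
  by (induction rule: eval.induct) (auto simp: coderivation_Node elim!: inference_cases)


section \<open>Progressing coderivations are total\<close>

lemma branch_tail:
  assumes "branch D b d"
  shows "d 0 < length (prems D)" "branch (prems D ! d 0) (\<lambda>i. b (Suc i)) (\<lambda>i. d (Suc i))"
proof -
  show "d 0 < length (prems D)"
    using assms unfolding branch_def by metis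
  show "branch (prems D ! d 0) (\<lambda>i. b (Suc i)) (\<lambda>i. d (Suc i))"
    using assms unfolding branch_def by simp metis
qed

lemma branch_Cons:
  "p < length (prems D) \<Longrightarrow> branch (prems D ! p) b d \<Longrightarrow> branch D (case_nat D b) (case_nat p d)"
  by (auto simp: branch_def split: nat.split)

text \<open>Prepending the root turns a branch of the premise into one of \<open>D\<close>; the
  thread found there is shifted back by one.\<close>

lemma progressing_prems:
  assumes "progressing D" "E \<in> set (prems D)"
  shows "progressing E"
  unfolding progressing_def
proof (intro allI impI)
  fix b d
  assume "branch E b d"
  from assms(2) obtain p where p: "p < length (prems D)" "prems D ! p = E"
    by (auto simp: in_set_conv_nth)
  let ?b = "case_nat D b" and ?d = "case_nat p d"
  have "branch D ?b ?d"
    using branch_Cons p \<open>branch E b d\<close> by blast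
  then obtain s t where st: "thread ?b ?d s t" "progressing_thread ?b s t"
    using assms(1) unfolding progressing_def by blast
  let ?t = "\<lambda>i. t (Suc i)"
  \<comment> \<open>The subtraction is truncated: a thread starting at the root of \<open>D\<close>
    loses its first occurrence and then starts at the root of \<open>E\<close>, where maximality is
    void.\<close>
  have "thread b d (s - 1) ?t"
    unfolding thread_def
  proof (intro conjI allI impI)
    fix i
    assume "s - 1 \<le> i"
    then have "s \<le> Suc i" by simp
    then show "occurs (?t i) (concl (b i))"
      and "ancestor (last_rule (b i)) (d i) (concl (b i)) (?t i) (?t (Suc i))"
      using st(1) unfolding thread_def by force+
  next
    show "\<nexists>j x. s - 1 = Suc j \<and> occurs x (concl (b j)) \<and>
      ancestor (last_rule (b j)) (d j) (concl (b j)) x (?t (s - 1))"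
    proof
      assume "\<exists>j x. s - 1 = Suc j \<and> occurs x (concl (b j)) \<and>
        ancestor (last_rule (b j)) (d j) (concl (b j)) x (?t (s - 1))"
      then obtain j x where "s = Suc (Suc j)" "occurs x (concl (b j))"
        "ancestor (last_rule (b j)) (d j) (concl (b j)) x (t s)"
        by (cases s) auto
      then show False
        using st(1) unfolding thread_def by (auto dest!: spec[of _ "Suc j"])
    qed
  qed
  moreover have "progressing_thread b (s - 1) ?t"
    unfolding progressing_thread_def
  proof
    obtain k where k: "k \<ge> s" "\<And>i. i \<ge> k \<Longrightarrow> \<exists>j. t i = OccB j"
      using st(2) unfolding progressing_thread_def by blast
    show "\<exists>k\<ge>s - 1. \<forall>i\<ge>k. \<exists>j. ?t i = OccB j"
      using k by (intro exI[of _ k]) auto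
    let ?I = "{i. s - 1 \<le> i \<and> last_rule (b i) \<in> {CondB, LCondB} \<and> ?t i = OccB 0}"
    \<comment> \<open>At most the index 0 is lost by the shift.\<close>
    have "{i. s \<le> i \<and> last_rule (?b i) \<in> {CondB, LCondB} \<and> t i = OccB 0} \<subseteq> insert 0 (Suc ` ?I)"
    proof
      fix i
      assume "i \<in> {i. s \<le> i \<and> last_rule (?b i) \<in> {CondB, LCondB} \<and> t i = OccB 0}"
      then show "i \<in> insert 0 (Suc ` ?I)"
        by (cases i) auto
    qed
    then show "infinite ?I"
      using st(2) unfolding progressing_thread_def by (meson finite_imageI finite_insert finite_subset)
  qed
  ultimately show "\<exists>s t. thread b d s t \<and> progressing_thread b s t"
    by blast
qed

inductive_cases ancestor_cases:
  "ancestor CutN p S x x'"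
  "ancestor CutB p (Seq m n A) x x'"
  "ancestor WeakN p S x x'"
  "ancestor WeakB p S x x'"
  "ancestor (ExN k) p S x x'"
  "ancestor (ExB k) p S x x'"
  "ancestor BoxL p S x x'"
  "ancestor BoxR p S x x'"
  "ancestor S0 p S x x'"
  "ancestor S1 p S x x'"
  "ancestor CondN p S x x'"
  "ancestor CondB p S x x'"
  "ancestor LCondN p S x x'"
  "ancestor LCondB p S x x'"

section \<open>Descent through undefined values\<close>

definition computes :: "coder \<Rightarrow> nat list \<Rightarrow> nat list \<Rightarrow> bool" where
  "computes D xs ys \<longleftrightarrow> (\<exists>z. eval D xs ys z)"

fun occ_value :: "nat list \<Rightarrow> nat list \<Rightarrow> occ \<Rightarrow> nat" where
  "occ_value xs ys (OccB i) = xs ! i"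
| "occ_value xs ys (OccN j) = ys ! j"

text \<open>Safe occurrences are included, so the sorts along a thread need no analysis. The
  principal formula has no ancestor in the leftmost premise of \<open>CondB\<close> or
  \<open>LCondB\<close>, so strictness is demanded only where the argument is halved.\<close>

definition descends :: "coder \<Rightarrow> nat \<Rightarrow> nat list \<Rightarrow> nat list \<Rightarrow> nat list \<Rightarrow> nat list \<Rightarrow> bool" where
  "descends D p xs ys xs' ys' \<longleftrightarrow>
     (\<forall>x x'. occurs x (concl D) \<longrightarrow> ancestor (last_rule D) p (concl D) x x' \<longrightarrow>
        occ_value xs' ys' x' \<le> occ_value xs ys x \<and>
        (last_rule D \<in> {CondB, LCondB} \<and> x = OccB 0 \<longrightarrow>
           occ_value xs' ys' x' < occ_value xs ys x))"

lemma all_occ: "(\<forall>x. P x) \<longleftrightarrow> (\<forall>i. P (OccB i)) \<and> (\<forall>j. P (OccN j))"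
  by (metis occ.exhaust)

lemma computes_iffs:
  "computes (Node S WeakN [D0]) xs (ys @ [y]) \<longleftrightarrow> computes D0 xs ys"
  "computes (Node S WeakB [D0]) (x # xs) ys \<longleftrightarrow> computes D0 xs ys"
  "computes (Node S BoxL [D0]) (x # xs) ys \<longleftrightarrow> computes D0 xs (ys @ [x])"
  "computes (Node S BoxR [D0]) xs [] \<longleftrightarrow> computes D0 xs []"
  "computes (Node S S0 [D0]) xs ys \<longleftrightarrow> computes D0 xs ys"
  "computes (Node S S1 [D0]) xs ys \<longleftrightarrow> computes D0 xs ys"
  "length us = k \<Longrightarrow> computes (Node S (ExN k) [D0]) xs (us @ a # b # vs) \<longleftrightarrow>
     computes D0 xs (us @ b # a # vs)"
  "length us = k \<Longrightarrow> computes (Node S (ExB k) [D0]) (us @ a # b # vs) ys \<longleftrightarrow>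
     computes D0 (us @ b # a # vs) ys"
  by (auto simp: computes_def eval_iffs eval_conditional_iffs)

lemma exchange_split:
  assumes "Suc k < length xs"
  shows "\<exists>us a b vs. xs = us @ a # b # vs \<and> length us = k"
proof -
  have "xs = take k xs @ xs ! k # xs ! Suc k # drop (Suc (Suc k)) xs"
    using assms by (simp add: Cons_nth_drop_Suc)
  moreover have "length (take k xs) = k"
    using assms by simp
  ultimately show ?thesis
    by blast
qed

lemma nat_bit_cases:
  obtains "(w::nat) = 0" | y where "w = 2 * y" "y \<noteq> 0" | y where "w = 2 * y + 1"
proof (cases "even w")
  case True
  then obtain y where "w = 2 * y" by (elim evenE)
  then show ?thesis using that by (cases "y = 0") auto
next
  case False
  then show ?thesis using that by (elim oddE) auto
qed

text \<open>If all premises that the evaluation consults had values, so would the conclusion; hence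
  one of them can be blamed, at the arguments with which it is consulted. A cut formula is not an
  ancestor of anything in the conclusion, so its value needs no bound.\<close>

lemma undefined_premise:
  assumes "coderivation {} (Node S r Ds)" "fits xs ys S" "\<not> computes (Node S r Ds) xs ys"
  shows "\<exists>p<length Ds. \<exists>xs' ys'. fits xs' ys' (concl (Ds ! p)) \<and> \<not> computes (Ds ! p) xs' ys' \<and>
    descends (Node S r Ds) p xs ys xs' ys'" (is "?goal")
proof -
  note descent = descends_def all_occ nth_append nth_Cons'
  have intro: ?goal if "p < length Ds" "fits xs' ys' (concl (Ds ! p))"
    "\<not> computes (Ds ! p) xs' ys'" "descends (Node S r Ds) p xs ys xs' ys'" for p xs' ys'
    using that by blast
  have "inference {} r (map concl Ds) S"
    using assms(1) by (simp add: coderivation_Node)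
  then show ?goal
  proof cases
    case 1
    then show ?thesis
      using assms(2,3) by (auto simp: computes_def length_Suc_conv intro: eval.intros)
  next
    case (2 m n B)
    then obtain D0 D1 where Ds: "Ds = [D0, D1]" "concl D0 = Seq m n TyN" "concl D1 = Seq m (Suc n) B"
      by (auto simp: map_eq_Cons_conv)
    show ?thesis
    \<comment> \<open>The right premise is consulted only at a value of the left one; if there is
      none, the left premise is to blame.\<close>
    proof (cases "computes D0 xs ys")
      case True
      then obtain z where "eval D0 xs ys z" by (auto simp: computes_def)
      then show ?thesis
        using assms(2,3) 2 Ds
        by (intro intro[of 1 xs "ys @ [z]"])
          (auto simp: descent computes_def eval_iffs elim!: ancestor_cases)
    next
      case False
      then show ?thesis
        using assms(2,3) 2 Ds
        by (intro intro[of 0 xs ys]) (auto simp: descent elim!: ancestor_cases)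
    qed
  next
    case (3 m n B)
    then obtain D0 D1 where Ds: "Ds = [D0, D1]" "concl D0 = Seq m n TyBox" "concl D1 = Seq (Suc m) n B"
      by (auto simp: map_eq_Cons_conv)
    show ?thesis
    proof (cases "computes D0 xs ys")
      case True
      then obtain z where "eval D0 xs ys z" by (auto simp: computes_def)
      then show ?thesis
        using assms(2,3) 3 Ds
        by (intro intro[of 1 "z # xs" ys])
          (auto simp: descent computes_def eval_iffs elim!: ancestor_cases)
    next
      case False
      then show ?thesis
        using assms(2,3) 3 Ds
        by (intro intro[of 0 xs ys]) (auto simp: descent elim!: ancestor_cases)
    qed
  next
    case (4 m n B)
    then obtain D0 ys0 y where "Ds = [D0]" "concl D0 = Seq m n B" "ys = ys0 @ [y]" "length ys0 = n"
      using assms(2) by (auto simp: map_eq_Cons_conv length_Suc_conv_rev)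
    then show ?thesis
      using assms(2,3) 4
      by (intro intro[of 0 xs ys0]) (auto simp: descent computes_iffs elim!: ancestor_cases)
  next
    case (5 m n B)
    then obtain D0 xs0 x where "Ds = [D0]" "concl D0 = Seq m n B" "xs = x # xs0" "length xs0 = m"
      using assms(2) by (auto simp: map_eq_Cons_conv length_Suc_conv)
    then show ?thesis
      using assms(2,3) 5
      by (intro intro[of 0 xs0 ys]) (auto simp: descent computes_iffs elim!: ancestor_cases)
  next
    case (6 k n m B)
    then obtain D0 where "Ds = [D0]" "concl D0 = Seq m n B"
      by (auto simp: map_eq_Cons_conv)
    moreover obtain us a b vs where "ys = us @ a # b # vs" "length us = k"
      using exchange_split[of k ys] assms(2) 6 by auto
    ultimately show ?thesis
      using assms(2,3) 6
      by (intro intro[of 0 xs "us @ b # a # vs"])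
        (auto simp: descent computes_iffs elim!: ancestor_cases)
  next
    case (7 k m n B)
    then obtain D0 where "Ds = [D0]" "concl D0 = Seq m n B"
      by (auto simp: map_eq_Cons_conv)
    moreover obtain us a b vs where "xs = us @ a # b # vs" "length us = k"
      using exchange_split[of k xs] assms(2) 7 by auto
    ultimately show ?thesis
      using assms(2,3) 7
      by (intro intro[of 0 "us @ b # a # vs" ys])
        (auto simp: descent computes_iffs elim!: ancestor_cases)
  next
    case (8 m n A)
    then obtain D0 xs0 x where "Ds = [D0]" "concl D0 = Seq m (Suc n) A" "xs = x # xs0" "length xs0 = m"
      using assms(2) by (auto simp: map_eq_Cons_conv length_Suc_conv)
    then show ?thesis
      using assms(2,3) 8
      by (intro intro[of 0 xs0 "ys @ [x]"]) (auto simp: descent computes_iffs elim!: ancestor_cases)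
  next
    case (9 m)
    then obtain D0 where "Ds = [D0]" "concl D0 = Seq m 0 TyN"
      by (auto simp: map_eq_Cons_conv)
    then show ?thesis
      using assms(2,3) 9
      by (intro intro[of 0 xs ys]) (auto simp: descent computes_iffs elim!: ancestor_cases)
  next
    case 10
    then show ?thesis
      using assms(2,3) by (auto simp: computes_def intro: eval.intros)
  next
    case 11
    then show ?thesis
      using assms(2,3) eval.intros(11) by (auto simp: computes_def)
  next
    case (12 m n A)
    then obtain D0 where "Ds = [D0]" "concl D0 = Seq m n A"
      by (auto simp: map_eq_Cons_conv)
    then show ?thesis
      using assms(2,3) 12
      by (intro intro[of 0 xs ys]) (auto simp: descent computes_iffs elim!: ancestor_cases)
  next
    case (13 m n A)
    then obtain D0 where "Ds = [D0]" "concl D0 = Seq m n A"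
      by (auto simp: map_eq_Cons_conv)
    then show ?thesis
      using assms(2,3) 13
      by (intro intro[of 0 xs ys]) (auto simp: descent computes_iffs elim!: ancestor_cases)
  next
    case (14 m n)
    then obtain D0 D1 D2 where Ds: "Ds = [D0, D1, D2]" "concl D0 = Seq m n TyN"
      "concl D1 = Seq m (Suc n) TyN" "concl D2 = Seq m (Suc n) TyN"
      by (auto simp: map_eq_Cons_conv)
    obtain ys0 w where ys: "ys = ys0 @ [w]" "length ys0 = n"
      using assms(2) 14 by (auto simp: length_Suc_conv_rev)
    show ?thesis
    proof (cases w rule: nat_bit_cases)
      case 1
      then have "\<not> computes D0 xs ys0"
        using assms(3) 14 Ds ys by (auto simp: computes_def intro: eval.intros)
      then show ?thesis
        using assms(2) 14 Ds ys
        by (intro intro[of 0 xs ys0]) (auto simp: descent elim!: ancestor_cases)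
    next
      case (2 y)
      then have "\<not> computes D1 xs (ys0 @ [y])"
        using assms(3) 14 Ds ys by (auto simp: computes_def eval_conditional_iffs)
      then show ?thesis
        using assms(2) 14 Ds ys 2
        by (intro intro[of 1 xs "ys0 @ [y]"]) (auto simp: descent elim!: ancestor_cases)
    next
      case (3 y)
      then have "\<not> computes D2 xs (ys0 @ [y])"
        using assms(3) 14 Ds ys by (auto simp: computes_def eval_iffs(10)[simplified])
      then show ?thesis
        using assms(2) 14 Ds ys 3
        by (intro intro[of 2 xs "ys0 @ [y]"]) (auto simp: descent elim!: ancestor_cases)
    qed
  next
    case (15 m n)
    then obtain D0 D1 D2 where Ds: "Ds = [D0, D1, D2]" "concl D0 = Seq m n TyN"
      "concl D1 = Seq (Suc m) n TyN" "concl D2 = Seq (Suc m) n TyN"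
      by (auto simp: map_eq_Cons_conv)
    obtain xs0 w where xs: "xs = w # xs0" "length xs0 = m"
      using assms(2) 15 by (auto simp: length_Suc_conv)
    show ?thesis
    \<comment> \<open>Strict descent comes from \<open>x < 2 * x\<close> for
      \<open>x \<noteq> 0\<close> and from \<open>x < 2 * x + 1\<close>.\<close>
    proof (cases w rule: nat_bit_cases)
      case 1
      then have "\<not> computes D0 xs0 ys"
        using assms(3) 15 Ds xs by (auto simp: computes_def intro: eval.intros)
      then show ?thesis
        using assms(2) 15 Ds xs
        by (intro intro[of 0 xs0 ys]) (auto simp: descent elim!: ancestor_cases)
    next
      case (2 x)
      then have "\<not> computes D1 (x # xs0) ys"
        using assms(3) 15 Ds xs by (auto simp: computes_def eval_conditional_iffs)
      then show ?thesis
        using assms(2) 15 Ds xs 2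
        by (intro intro[of 1 "x # xs0" ys]) (auto simp: descent elim!: ancestor_cases)
    next
      case (3 x)
      then have "\<not> computes D2 (x # xs0) ys"
        using assms(3) 15 Ds xs by (auto simp: computes_def eval_iffs(12)[simplified])
      then show ?thesis
        using assms(2) 15 Ds xs 3
        by (intro intro[of 2 "x # xs0" ys]) (auto simp: descent elim!: ancestor_cases)
    qed
  next
    case (16 m n)
    then obtain D0 D1 where Ds: "Ds = [D0, D1]" "concl D0 = Seq m n TyN" "concl D1 = Seq m (Suc n) TyN"
      by (auto simp: map_eq_Cons_conv)
    obtain ys0 w where ys: "ys = ys0 @ [w]" "length ys0 = n"
      using assms(2) 16 by (auto simp: length_Suc_conv_rev)
    show ?thesis
    proof (cases "w = 0")
      case True
      then have "\<not> computes D0 xs ys0"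
        using assms(3) 16 Ds ys by (auto simp: computes_def intro: eval.intros)
      then show ?thesis
        using assms(2) 16 Ds ys
        by (intro intro[of 0 xs ys0]) (auto simp: descent elim!: ancestor_cases)
    next
      case False
      then have "\<not> computes D1 xs (ys0 @ [w div 2])"
        using assms(3) 16 Ds ys eval.intros(21)[of D1 xs ys0 "w div 2" _ "w mod 2"]
        by (cases "even w") (auto simp: computes_def even_iff_mod_2_eq_zero odd_iff_mod_2_eq_one)
      then show ?thesis
        using assms(2) 16 Ds ys
        by (intro intro[of 1 xs "ys0 @ [w div 2]"]) (auto simp: descent elim!: ancestor_cases)
    qed
  next
    case (17 m n)
    then obtain D0 D1 where Ds: "Ds = [D0, D1]" "concl D0 = Seq m n TyN" "concl D1 = Seq (Suc m) n TyN"
      by (auto simp: map_eq_Cons_conv)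
    obtain xs0 w where xs: "xs = w # xs0" "length xs0 = m"
      using assms(2) 17 by (auto simp: length_Suc_conv)
    show ?thesis
    proof (cases "w = 0")
      case True
      then have "\<not> computes D0 xs0 ys"
        using assms(3) 17 Ds xs by (auto simp: computes_def intro: eval.intros)
      then show ?thesis
        using assms(2) 17 Ds xs
        by (intro intro[of 0 xs0 ys]) (auto simp: descent elim!: ancestor_cases)
    next
      case False
      then have "\<not> computes D1 (w div 2 # xs0) ys"
        using assms(3) 17 Ds xs eval.intros(23)[of D1 "w div 2" xs0 ys _ "w mod 2"]
        by (cases "even w") (auto simp: computes_def even_iff_mod_2_eq_zero odd_iff_mod_2_eq_one)
      then show ?thesis
        using assms(2) 17 Ds xs False
        by (intro intro[of 1 "w div 2 # xs0" ys]) (auto simp: descent elim!: ancestor_cases)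
    qed
  qed simp
qed

text \<open>From \<open>s\<close> on, \<open>v\<close> attains a minimum at some \<open>k\<close>; a
  strict step after \<open>k\<close> would go below it.\<close>

lemma no_infinite_descent:
  fixes v :: "nat \<Rightarrow> nat"
  assumes "\<And>i. i \<ge> s \<Longrightarrow> v (Suc i) \<le> v i"
    and "\<And>i. i \<ge> s \<Longrightarrow> P i \<Longrightarrow> v (Suc i) < v i"
    and "infinite {i. s \<le> i \<and> P i}"
  shows False
proof -
  obtain k where k: "k \<ge> s" "\<And>i. i \<ge> s \<Longrightarrow> v k \<le> v i"
    using ex_has_least_nat[of "\<lambda>i. i \<ge> s" s v] by auto
  obtain i where i: "i > k" "s \<le> i" "P i"
    using assms(3) finite_subset[of "{i. s \<le> i \<and> P i}" "{..k}"] by (force simp: not_le)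
  have "v i \<le> v k"
    using \<open>i > k\<close>[THEN less_imp_le]
  proof (induction i rule: dec_induct)
    case (step j)
    then show ?case using assms(1)[of j] k(1) by linarith
  qed simp
  moreover have "v (Suc i) < v i" "v k \<le> v (Suc i)"
    using assms(2) k(2) i by auto
  ultimately show False by simp
qed

lemma progressing_computes:
  assumes "coderivation {} D" "progressing D" "fits xs ys (concl D)"
  shows "computes D xs ys"
proof (rule ccontr)
  assume "\<not> computes D xs ys"
  define undef where "undef = (\<lambda>(E, us, vs). coderivation {} E \<and> fits us vs (concl E) \<and> \<not> computes E us vs)"
  define succ where "succ = (\<lambda>(E, us, vs) (E', us', vs').
    \<exists>p<length (prems E). E' = prems E ! p \<and> descends E p us vs us' vs')"
  \<comment> \<open>Dependent choice leaves the first state open, so the clause for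
    \<open>i = 0\<close> pins it to the given coderivation and arguments.\<close>
  have "\<exists>f. \<forall>i. (undef (f i) \<and> (i = 0 \<longrightarrow> f i = (D, xs, ys))) \<and> succ (f i) (f (Suc i))"
  proof (rule dependent_nat_choice)
    show "\<exists>st. undef st \<and> (0 = (0::nat) \<longrightarrow> st = (D, xs, ys))"
      using assms(1,3) \<open>\<not> computes D xs ys\<close> by (auto simp: undef_def)
  next
    fix st and i :: nat
    assume "undef st \<and> (i = 0 \<longrightarrow> st = (D, xs, ys))"
    moreover obtain E us vs where st: "st = (E, us, vs)" by (cases st)
    moreover obtain S r Ds where E: "E = Node S r Ds" by (cases E)
    ultimately have E': "coderivation {} (Node S r Ds)" "fits us vs S" "\<not> computes (Node S r Ds) us vs"
      by (auto simp: undef_def)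
    then obtain p us' vs' where p: "p < length Ds" "fits us' vs' (concl (Ds ! p))"
      "\<not> computes (Ds ! p) us' vs'" "descends (Node S r Ds) p us vs us' vs'"
      using undefined_premise by blast
    have "undef (Ds ! p, us', vs')"
      using E'(1) p by (auto simp: undef_def coderivation_Node)
    moreover have "succ st (Ds ! p, us', vs')"
      using p by (auto simp: succ_def st E)
    ultimately show "\<exists>st'. (undef st' \<and> (Suc i = 0 \<longrightarrow> st' = (D, xs, ys))) \<and> succ st st'"
      by blast
  qed
  then obtain f where f: "f 0 = (D, xs, ys)" "\<And>i. succ (f i) (f (Suc i))"
    by blast
  define b where "b = (\<lambda>i. fst (f i))"
  define us where "us = (\<lambda>i. fst (snd (f i)))"
  define vs where "vs = (\<lambda>i. snd (snd (f i)))"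
  have "\<exists>p. p < length (prems (b i)) \<and> b (Suc i) = prems (b i) ! p \<and>
      descends (b i) p (us i) (vs i) (us (Suc i)) (vs (Suc i))" for i
    using f(2)[of i] by (auto simp: succ_def b_def us_def vs_def split: prod.splits)
  then obtain d where d: "\<And>i. d i < length (prems (b i))" "\<And>i. b (Suc i) = prems (b i) ! d i"
      "\<And>i. descends (b i) (d i) (us i) (vs i) (us (Suc i)) (vs (Suc i))"
    by metis
  have "branch D b d"
    using d f(1) by (simp add: branch_def b_def)
  then obtain s t where st: "thread b d s t" "progressing_thread b s t"
    using assms(2) unfolding progressing_def by blast
  let ?v = "\<lambda>i. occ_value (us i) (vs i) (t i)"
  have step: "?v (Suc i) \<le> ?v i \<and> (last_rule (b i) \<in> {CondB, LCondB} \<and> t i = OccB 0 \<longrightarrow> ?v (Suc i) < ?v i)"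
    if "i \<ge> s" for i
    using d(3)[of i] st(1) that unfolding descends_def thread_def by blast
  show False
    by (rule no_infinite_descent[of s ?v "\<lambda>i. last_rule (b i) \<in> {CondB, LCondB} \<and> t i = OccB 0"])
      (use step st(2) in \<open>auto simp: progressing_thread_def\<close>)
qed


section \<open>Coderivations without bit-sensitive rules\<close>

lemma subcoders_trans: "E' \<in> subcoders E \<Longrightarrow> E \<in> subcoders D \<Longrightarrow> E' \<in> subcoders D"
  by (induction rule: subcoders.induct) (auto intro: subcoders.intros)

lemma subcoders_Node: "subcoders (Node S r Ds) = insert (Node S r Ds) (\<Union>D\<in>set Ds. subcoders D)"
proof
  show "subcoders (Node S r Ds) \<subseteq> insert (Node S r Ds) (\<Union>D\<in>set Ds. subcoders D)"
  proof
    fix E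
    assume "E \<in> subcoders (Node S r Ds)"
    then show "E \<in> insert (Node S r Ds) (\<Union>D\<in>set Ds. subcoders D)"
      by induction (auto intro: subcoders.intros)
  qed
  have "D \<in> subcoders (Node S r Ds)" if "D \<in> set Ds" for D
    using that by (auto intro: subcoders.intros(2)[OF subcoders.intros(1)])
  then show "insert (Node S r Ds) (\<Union>D\<in>set Ds. subcoders D) \<subseteq> subcoders (Node S r Ds)"
    by (auto intro: subcoders.intros subcoders_trans)
qed

text \<open>The negation of the condition counted by \<open>rule_regular\<close>: a coderivation in
  \<open>nuB\<close> has only finitely many sub-coderivations without this property.\<close>

definition length_coder :: "coder \<Rightarrow> bool" where
  "length_coder E \<longleftrightarrow> (\<forall>E' \<in> subcoders E. last_rule E' \<notin> {CondB, CondN, S0, S1, Id})"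

lemma length_coder_Node:
  "length_coder (Node S r Ds) \<longleftrightarrow>
     r \<notin> {CondB, CondN, S0, S1, Id} \<and> (\<forall>D \<in> set Ds. length_coder D)"
  by (auto simp: length_coder_def subcoders_Node)

text \<open>The only possible leaves are \<open>Zero\<close> and \<open>One\<close>, and every
  remaining rule hands on a value of one of its premises unchanged.\<close>

lemma length_coder_values:
  "eval E xs ys z \<Longrightarrow> coderivation {} E \<Longrightarrow> length_coder E \<Longrightarrow> z \<in> {0, 1}"
  by (induction rule: eval.induct)
    (auto simp: coderivation_Node length_coder_Node elim: inference_cases)

section \<open>Binary lengths under halving\<close>

lemma floorlog_eq_0_iff: "floorlog 2 x = floorlog 2 0 \<longleftrightarrow> x = 0" "floorlog 2 0 = floorlog 2 x \<longleftrightarrow> x = 0"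
  by (auto simp: compute_floorlog)

lemma floorlog_double_plus_bit:
  "i \<in> {0, 1} \<Longrightarrow> 2 * y + i \<noteq> 0 \<Longrightarrow> floorlog 2 (2 * y + i) = Suc (floorlog 2 y)"
  by (subst compute_floorlog) auto

text \<open>The last digits may differ, which \<open>LCondN\<close> and \<open>LCondB\<close> do not
  notice: they send both digits to the same premise.\<close>

lemma floorlog_eq_double_plus_bit:
  assumes "floorlog 2 w = floorlog 2 (2 * y + i)" "i \<in> {0, 1}" "2 * y + i \<noteq> 0"
  obtains y' i' where "w = 2 * y' + i'" "i' \<in> {0, 1}" "2 * y' + i' \<noteq> 0" "floorlog 2 y' = floorlog 2 y"
proof -
  have "w \<noteq> 0"
    using assms floorlog_double_plus_bit[of i y] compute_floorlog[of 2 0] by (cases "w = 0") simp_all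
  moreover have "w mod 2 \<in> {0, 1}" by auto
  moreover have "floorlog 2 (2 * (w div 2) + w mod 2) = Suc (floorlog 2 (w div 2))"
    using calculation by (intro floorlog_double_plus_bit) auto
  ultimately show ?thesis
    using that[of "w div 2" "w mod 2"] assms floorlog_double_plus_bit by auto
qed

lemma map_eq_exchange:
  assumes "map f zs = map f (us @ a # b # vs)"
  obtains us' a' b' vs' where "zs = us' @ a' # b' # vs'" "length us' = length us"
    "map f (us' @ b' # a' # vs') = map f (us @ b # a # vs)"
proof -
  obtain us' ws where "zs = us' @ ws" "map f us' = map f us" "map f ws = map f (a # b # vs)"
    using assms by (auto simp: map_eq_append_conv)
  moreover from this(3) obtain a' b' vs' where "ws = a' # b' # vs'" "f a' = f a" "f b' = f b"
      "map f vs' = map f vs"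
    by (auto simp: map_eq_Cons_conv)
  ultimately show ?thesis
    using that[of us' a' b' vs'] map_eq_imp_length_eq by fastforce
qed

text \<open>The evaluation branches only on whether an argument is zero. Arguments are permuted,
  dropped or halved, all of which respects equality of lengths, and the values of cut formulas agree
  exactly by induction. So the same premises are consulted.\<close>

lemma length_coder_invariant:
  "eval E xs ys z \<Longrightarrow> coderivation {} E \<Longrightarrow> length_coder E \<Longrightarrow>
     map (floorlog 2) xs' = map (floorlog 2) xs \<Longrightarrow> map (floorlog 2) ys' = map (floorlog 2) ys \<Longrightarrow>
     eval E xs' ys' z"
proof (induction arbitrary: xs' ys' rule: eval.induct)
  case (2 D0 xs ys z D1 w S)
  then show ?case
    by (auto simp: coderivation_Node length_coder_Node intro!: eval.intros(2)[of D0 _ _ z])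
next
  case (3 D0 xs ys z D1 w S)
  then show ?case
    by (auto simp: coderivation_Node length_coder_Node intro!: eval.intros(3)[of D0 _ _ z])
next
  case (4 D0 xs ys z S y)
  then show ?case
    by (auto simp: coderivation_Node length_coder_Node map_eq_append_conv eval_iffs)
next
  case (6 D0 xs us b a vs z k S)
  then obtain us' a' b' vs' where "ys' = us' @ a' # b' # vs'" "length us' = k"
    "map (floorlog 2) (us' @ b' # a' # vs') = map (floorlog 2) (us @ b # a # vs)"
    using map_eq_exchange by metis
  with 6 show ?case
    by (simp add: coderivation_Node length_coder_Node eval_conditional_iffs del: map_append)
next
  case (7 D0 us b a vs ys z k S)
  then obtain us' a' b' vs' where "xs' = us' @ a' # b' # vs'" "length us' = k"
    "map (floorlog 2) (us' @ b' # a' # vs') = map (floorlog 2) (us @ b # a # vs)"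
    using map_eq_exchange by metis
  with 7 show ?case
    by (simp add: coderivation_Node length_coder_Node eval_conditional_iffs del: map_append)
next
  case (10 S)
  then show ?case by (auto intro: eval.intros)
next
  case (11 S)
  then show ?case by (auto intro: eval.intros(11)[simplified])
next
  case (20 D0 xs ys z S D1)
  then show ?case
    by (auto simp: coderivation_Node length_coder_Node map_eq_append_conv floorlog_eq_0_iff eval_iffs)
next
  case (21 D1 xs ys y z i S D0)
  from 21(8) obtain us w where ys': "ys' = us @ [w]" "map (floorlog 2) us = map (floorlog 2) ys"
    "floorlog 2 w = floorlog 2 (2 * y + i)"
    by (auto simp: map_eq_append_conv)
  then obtain y' i' where w: "w = 2 * y' + i'" "i' \<in> {0, 1}" "2 * y' + i' \<noteq> 0"
    "floorlog 2 y' = floorlog 2 y"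
    using floorlog_eq_double_plus_bit "21.hyps" by metis
  have "eval D1 xs' (us @ [y']) z"
    using 21 ys' w by (auto simp: coderivation_Node length_coder_Node)
  then show ?case
    using w ys' eval.intros(21) by metis
next
  case (23 D1 x xs ys z i S D0)
  from 23(7) obtain us w where xs': "xs' = w # us" "map (floorlog 2) us = map (floorlog 2) xs"
    "floorlog 2 w = floorlog 2 (2 * x + i)"
    by auto
  then obtain x' i' where w: "w = 2 * x' + i'" "i' \<in> {0, 1}" "2 * x' + i' \<noteq> 0"
    "floorlog 2 x' = floorlog 2 x"
    using floorlog_eq_double_plus_bit "23.hyps" by metis
  have "eval D1 (x' # us) ys' z"
    using 23 xs' w by (auto simp: coderivation_Node length_coder_Node)
  then show ?case
    using w xs' eval.intros(23) by metis
next
  case (24 g xs ys z S)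
  then show ?case by (auto simp: coderivation_Node elim: inference_cases)
qed (auto simp: coderivation_Node length_coder_Node map_eq_Cons_conv floorlog_eq_0_iff eval_iffs)

text \<open>A \<open>\<box>N\<close> can only be introduced by \<^const>\<open>BoxR\<close>, where no safe argument is present.\<close>

lemma box_ignores_safe:
  "eval E xs ys z \<Longrightarrow> coderivation {} E \<Longrightarrow> progressing E \<Longrightarrow> concl E = Seq m n TyBox \<Longrightarrow>
     length ys' = n \<Longrightarrow> eval E xs ys' z"
proof (induction arbitrary: m n ys' rule: eval.induct)
  case (2 D0 xs ys z D1 w S)
  then have D: "coderivation {} D0" "coderivation {} D1" "progressing D0" "progressing D1"
      "concl D0 = Seq m n TyN" "concl D1 = Seq m (Suc n) TyBox"
    by (auto simp: coderivation_Node elim: inference_cases intro: progressing_prems)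
  moreover have "length xs = m"
    using eval_fits[OF 2(1) D(1)] D(5) by simp
  \<comment> \<open>The left premise concludes \<open>TyN\<close> and may take another value on
    \<open>ys'\<close>; totality provides some \<open>z'\<close>. As it enters the right premise as
    a safe argument, the induction hypothesis allows \<open>z\<close> to be exchanged for
    it.\<close>
  ultimately obtain z' where "eval D0 xs ys' z'"
    using progressing_computes[of D0 xs ys'] 2(8) by (auto simp: computes_def)
  moreover have "eval D1 xs (ys' @ [z']) w"
    using 2 D by simp
  ultimately show ?case by (rule eval.intros)
next
  case (3 D0 xs ys z D1 w S)
  then have D: "coderivation {} D0" "coderivation {} D1" "progressing D0" "progressing D1"
      "concl D0 = Seq m n TyBox" "concl D1 = Seq (Suc m) n TyBox"
    by (auto simp: coderivation_Node elim: inference_cases intro: progressing_prems)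
  then have "eval D0 xs ys' z" "eval D1 (z # xs) ys' w"
    using 3 by auto
  then show ?case by (rule eval.intros)
next
  case (4 D0 xs ys z S y)
  then have D: "coderivation {} D0" "progressing D0"
    by (auto simp: coderivation_Node intro: progressing_prems)
  from 4 obtain n' us w where "n = Suc n'" "concl D0 = Seq m n' TyBox" "ys' = us @ [w]" "length us = n'"
    by (auto simp: coderivation_Node length_Suc_conv_rev elim!: inference_cases)
  with 4 D show ?case
    by (simp add: eval_iffs)
next
  case (5 D0 xs ys z S x)
  then have D: "coderivation {} D0" "progressing D0"
    by (auto simp: coderivation_Node intro: progressing_prems)
  from 5 obtain m' where "concl D0 = Seq m' n TyBox"
    by (auto simp: coderivation_Node elim!: inference_cases)
  with 5 D show ?case
    by (simp add: eval_iffs)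
next
  case (6 D0 xs us b a vs z k S)
  then have D: "coderivation {} D0" "progressing D0"
    by (auto simp: coderivation_Node intro: progressing_prems)
  from 6 have "concl D0 = Seq m n TyBox" "Suc k < n"
    by (auto simp: coderivation_Node elim!: inference_cases)
  moreover from this obtain us' a' b' vs' where "ys' = us' @ a' # b' # vs'" "length us' = k"
    using exchange_split[of k ys'] 6 by auto
  ultimately show ?case
    using 6 D by (simp add: eval_conditional_iffs)
next
  case (7 D0 us b a vs ys z k S)
  then have D: "coderivation {} D0" "progressing D0"
    by (auto simp: coderivation_Node intro: progressing_prems)
  from 7 have "concl D0 = Seq m n TyBox"
    by (auto simp: coderivation_Node elim!: inference_cases)
  then show ?case
    using 7 D by (simp add: eval_conditional_iffs)
next
  case (8 D0 xs ys x z S)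
  then have D: "coderivation {} D0" "progressing D0"
    by (auto simp: coderivation_Node intro: progressing_prems)
  from 8 obtain m' where "concl D0 = Seq m' (Suc n) TyBox"
    by (auto simp: coderivation_Node elim!: inference_cases)
  with 8 D show ?case
    by (simp add: eval_iffs)
next
  case (12 D0 xs ys z S)
  then have D: "coderivation {} D0" "progressing D0" "concl D0 = Seq m n TyBox"
    by (auto simp: coderivation_Node elim!: inference_cases intro: progressing_prems)
  with 12 show ?case
    by (auto intro: eval.intros)
next
  case (13 D0 xs ys z S)
  then have D: "coderivation {} D0" "progressing D0" "concl D0 = Seq m n TyBox"
    by (auto simp: coderivation_Node elim!: inference_cases intro: progressing_prems)
  with 13 show ?case
    by (auto intro: eval.intros(13)[simplified])
next
  case (9 D0 xs z S)
  then show ?case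
    by (auto simp: coderivation_Node elim!: inference_cases intro: eval.intros)
qed (auto simp: coderivation_Node elim!: inference_cases)


section \<open>Replacing bit-insensitive parts by initial sequents\<close>

text \<open>The last \<open>l\<close> safe arguments are fixed to 0. The replacement uses
  \<open>l = 0\<close> for a conclusion \<open>TyN\<close> and \<open>k = 0\<close> for
  \<open>TyBox\<close>.\<close>

definition length_function :: "coder \<Rightarrow> nat \<Rightarrow> nat \<Rightarrow> nat \<Rightarrow> two_sorted" where
  "length_function E m k l = Two_Sorted m k (\<lambda>xs ys.
     if length xs = m \<and> length ys = k then Some (THE z. eval E xs (ys @ replicate l 0) z) else None)"

lemma the_eval: "eval E xs ys z \<Longrightarrow> (THE z. eval E xs ys z) = z"
  by (blast intro: the_equality eval_deterministic)

lemma length_function_in_Rns: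
  assumes "coderivation {} E" "progressing E" "length_coder E" "concl E = Seq m (k + l) A"
  shows "length_function E m k l \<in> Rns"
proof -
  \<comment> \<open>A relation takes a single list, which is cut after the \<open>m\<close> normal
    arguments.\<close>
  let ?r = "\<lambda>zs. THE z. eval E (take m zs) (drop m zs @ replicate l 0) z"
  have computed: "\<exists>z. eval E (take m zs) (drop m zs @ replicate l 0) z \<and> ?r zs = z"
    if "length zs = m + k" for zs
    using progressing_computes[OF assms(1,2), of "take m zs" "drop m zs @ replicate l 0"]
      assms(4) that the_eval by (auto simp: computes_def)
  have "(m + k, ?r) \<in> length_relations"
    unfolding length_relations_def mem_Collect_eq prod.case
  proof (intro conjI allI impI)
    fix zs :: "nat list"
    assume "length zs = m + k"
    then show "?r zs \<in> {0, 1}"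
      using computed length_coder_values assms(1,3) by metis
  next
    fix zs zs' :: "nat list"
    assume len: "length zs = m + k" "length zs' = m + k"
      and eq: "map (floorlog 2) zs = map (floorlog 2) zs'"
    obtain z where z: "eval E (take m zs) (drop m zs @ replicate l 0) z" "?r zs = z"
      using computed[OF len(1)] by blast
    \<comment> \<open>The padding zeros are common to both sides, so equal lengths of
      \<open>zs\<close> and \<open>zs'\<close> suffice.\<close>
    have "eval E (take m zs') (drop m zs' @ replicate l 0) z"
      by (rule length_coder_invariant[OF z(1) assms(1,3)])
        (use eq in \<open>simp_all add: take_map[symmetric] drop_map[symmetric]\<close>)
    then show "?r zs = ?r zs'"
      using the_eval z(2) by metis
  qed
  moreover have "length_function E m k l = Two_Sorted m k
      (\<lambda>xs ys. if length xs = m \<and> length ys = k then Some (?r (xs @ ys)) else None)"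
    by (auto simp: length_function_def fun_eq_iff)
  ultimately show ?thesis
    unfolding Rns_def mem_Collect_eq by (intro exI[of _ m] exI[of _ k] exI[of _ ?r] conjI)
qed

definition length_leaf :: "coder \<Rightarrow> nat \<Rightarrow> nat \<Rightarrow> nat \<Rightarrow> coder" where
  "length_leaf E m k l = Node (Seq m k TyN) (Init (length_function E m k l)) []"

primrec weaken_safe :: "nat \<Rightarrow> coder \<Rightarrow> nat \<Rightarrow> coder" where
  "weaken_safe m D 0 = D"
| "weaken_safe m D (Suc n) = Node (Seq m (Suc n) TyBox) WeakN [weaken_safe m D n]"

text \<open>
  Initial sequents conclude \<open>N\<close>. A coderivation of a \<open>\<box>N\<close> does not depend on its safe arguments, so
  they can be fixed to \<open>0\<close>, which makes \<^const>\<open>BoxR\<close> applicable.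
\<close>

definition collapse :: "coder \<Rightarrow> coder" where
  "collapse E = (case concl E of Seq m n A \<Rightarrow>
     if A = TyN then length_leaf E m n 0
     else weaken_safe m (Node (Seq m 0 TyBox) BoxR [length_leaf E m 0 n]) n)"

lemma concl_weaken_safe:
  "concl D = Seq m 0 TyBox \<Longrightarrow> concl (weaken_safe m D n) = Seq m n TyBox"
  by (cases n) auto

lemma concl_collapse [simp]: "concl (collapse E) = concl E"
proof -
  obtain m n A where "concl E = Seq m n A" by (cases "concl E")
  then show ?thesis
    by (cases A) (auto simp: collapse_def length_leaf_def concl_weaken_safe)
qed

lemma coderivation_collapse:
  assumes "coderivation {} E" "progressing E" "length_coder E"
  shows "coderivation Rns (collapse E)"
proof -
  obtain m n A where E: "concl E = Seq m n A" by (cases "concl E")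
  have leaf: "coderivation Rns (length_leaf E m k l)" if "n = k + l" for k l
  proof -
    have "inference Rns (Init (length_function E m k l)) []
        (Seq (normal (length_function E m k l)) (safe (length_function E m k l)) TyN)"
      using length_function_in_Rns assms E that by (intro inference.intros) blast
    then show ?thesis
      by (simp add: length_leaf_def coderivation_Node length_function_def)
  qed
  have weaken: "coderivation Rns (weaken_safe m D k)"
    if "coderivation Rns D" "concl D = Seq m 0 TyBox" for D k
    using that by (induction k) (auto simp: coderivation_Node concl_weaken_safe intro: inference.intros)
  have "coderivation Rns (Node (Seq m 0 TyBox) BoxR [length_leaf E m 0 n])"
    using leaf[of 0 n] by (auto simp: coderivation_Node length_leaf_def intro: inference.intros)
  then show ?thesis
    using leaf[of n 0] weaken E by (auto simp: collapse_def)
qed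

lemma eval_collapse:
  assumes "eval E xs ys z" "coderivation {} E" "progressing E" "length_coder E"
  shows "eval (collapse E) xs ys z"
proof -
  obtain m n A where E: "concl E = Seq m n A" by (cases "concl E")
  then have len: "length xs = m" "length ys = n"
    using eval_fits assms(1,2) by fastforce+
  show ?thesis
  proof (cases A)
    case TyN
    then show ?thesis
      using E len the_eval[OF assms(1)]
      by (auto simp: collapse_def length_leaf_def length_function_def intro: eval.intros)
  next
    case TyBox
    \<comment> \<open>The leaf records only the values at safe arguments 0.\<close>
    have "eval E xs (replicate n 0) z"
      using box_ignores_safe assms(1-3) E TyBox by simp
    then have "eval (Node (Seq m 0 TyBox) BoxR [length_leaf E m 0 n]) xs [] z"
      using E len the_eval by (auto simp: length_leaf_def length_function_def intro!: eval.intros)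
    then have "eval (weaken_safe m (Node (Seq m 0 TyBox) BoxR [length_leaf E m 0 n]) k) xs vs z"
      if "length vs = k" for k vs
      using that
    proof (induction k arbitrary: vs)
      case (Suc k)
      then obtain us v where "vs = us @ [v]" "length us = k"
        by (auto simp: length_Suc_conv_rev)
      with Suc show ?case by (simp add: eval_iffs)
    qed simp
    then show ?thesis
      using E len TyBox by (auto simp: collapse_def)
  qed
qed

lemma finite_subcoders_collapse: "finite (subcoders (collapse E))"
proof -
  have "finite (subcoders D) \<Longrightarrow> finite (subcoders (weaken_safe m D n))" for m D n
    by (induction n) (auto simp: subcoders_Node)
  moreover have "finite (subcoders (length_leaf E m k l))" for m k l
    by (simp add: length_leaf_def subcoders_Node)
  ultimately show ?thesis
    by (simp add: collapse_def subcoders_Node split: sequent.split)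
qed

text \<open>The replacement is a finite chain of inferences above which stands an initial
  sequent.\<close>

lemma no_branch_collapse: "\<not> branch (collapse E) b d"
proof -
  have "\<not> branch (length_leaf E m k l) b d" for m k l b d
    using branch_tail[of "length_leaf E m k l" b d] by (auto simp: length_leaf_def)
  then have "\<not> branch (Node S r [length_leaf E m k l]) b d" for S r m k l b d
    using branch_tail[of "Node S r [length_leaf E m k l]" b d] by auto
  moreover have "\<forall>b d. \<not> branch D b d \<Longrightarrow> \<not> branch (weaken_safe m D n) b d" for m D n b d
  proof (induction n arbitrary: b d)
    case (Suc n)
    then show ?case
      using branch_tail[of "weaken_safe m D (Suc n)" b d] by auto
  qed simp
  ultimately show ?thesis
    using \<open>\<And>m k l b d. \<not> branch (length_leaf E m k l) b d\<close>
    by (auto simp: collapse_def split: sequent.split)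
qed

section \<open>Pruning and its semantics\<close>

primcorec prune :: "coder \<Rightarrow> coder" where
  "prune E = (if length_coder E then collapse E else Node (concl E) (last_rule E) (map prune (prems E)))"

lemma prune_length_coder: "length_coder E \<Longrightarrow> prune E = collapse E"
  by (subst prune.code) simp

lemma prune_other:
  "\<not> length_coder E \<Longrightarrow> prune E = Node (concl E) (last_rule E) (map prune (prems E))"
  by (subst prune.code) simp

lemma concl_prune [simp]: "concl (prune E) = concl E"
  by (cases "length_coder E") (simp_all add: prune_length_coder prune_other)

lemma coderivation_prune:
  assumes "coderivation {} E" "progressing E"
  shows "coderivation Rns (prune E)"
proof -
  define X where "X D \<longleftrightarrow> (\<exists>E. D = prune E \<and> coderivation {} E \<and> progressing E)" for D
  have "X (prune E)"
    using assms unfolding X_def by blast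
  then show ?thesis
  proof (coinduction arbitrary: E rule: coderivation.coinduct)
    case (coderivation E)
    then obtain E' where E': "prune E = prune E'" "coderivation {} E'" "progressing E'"
      unfolding X_def by blast
    obtain S r Ds where Node: "E' = Node S r Ds" by (cases E')
    show ?case
    proof (cases "length_coder E'")
      case True
      obtain S' r' Ds' where eq: "collapse E' = Node S' r' Ds'" by (cases "collapse E'")
      \<comment> \<open>The premises of a collapsed root need not be pruned coderivations;
        coinduction also accepts them as coderivations established outright.\<close>
      have "coderivation Rns (Node S' r' Ds')"
        using coderivation_collapse E'(2,3) True eq by metis
      then show ?thesis
        using E'(1) True eq by (auto simp: prune_length_coder coderivation_Node)
    next
      case False
      have "inference Rns r (map concl Ds) S"
        using E'(2) Node by (auto simp: coderivation_Node intro: inference_mono)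
      moreover have "X (prune D)" if "D \<in> set Ds" for D
        using that coderivation_prems[OF E'(2), of D] progressing_prems[OF E'(3), of D] Node
        unfolding X_def by auto
      ultimately show ?thesis
        using False E'(1) Node by (auto simp: prune_other comp_def simp del: prune.simps)
    qed
  qed
qed

lemma eval_prune:
  assumes "eval E xs ys z" "coderivation {} E" "progressing E"
  shows "eval (prune E) xs ys z"
proof -
  define good where "good E \<longleftrightarrow> coderivation {} E \<and> progressing E" for E
  \<comment> \<open>The induction cannot run on \<open>prune\<close> itself, since a collapsed root
    does not have the pruned premises. It runs on \<open>copy\<close>, which always keeps the root
    rule; \<open>step\<close> then passes from \<open>copy\<close> to \<open>prune\<close> at each
    premise, by \<open>eval_collapse\<close> where they differ.\<close>
  define copy where "copy E = Node (concl E) (last_rule E) (map prune (prems E))" for E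
  have step: "eval (prune E) xs ys z" if "eval E xs ys z" "good E" "eval (copy E) xs ys z" for E xs ys z
    using that eval_collapse
    by (cases "length_coder E") (auto simp: prune_length_coder prune_other good_def copy_def)
  have copy_Node: "copy (Node S r Ds) = Node S r (map prune Ds)" for S r Ds
    by (simp add: copy_def)
  have good_Node: "\<forall>D \<in> set Ds. good D" if "good (Node S r Ds)" for S r Ds
    using that coderivation_prems[of "{}" "Node S r Ds"] progressing_prems[of "Node S r Ds"]
    unfolding good_def by auto
  have "eval (copy E) xs ys z" if "eval E xs ys z" "good E" for E xs ys z
    using that
  proof (induction rule: eval.induct)
    case (1 S y)
    show ?case by (simp add: copy_Node eval.intros)
  next
    case (10 S)
    show ?case by (simp add: copy_Node eval.intros)
  next
    case (11 S)
    show ?case using eval.intros(11) by (simp add: copy_Node)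
  next
    case (24 g xs ys z S)
    then show ?case by (simp add: copy_Node eval.intros)
  qed (drule good_Node,
      simp add: copy_Node eval_iffs eval_iffs(10,12)[simplified] eval_conditional_iffs,
      blast intro: step)+
  then show ?thesis
    using assms step by (simp add: good_def)
qed

lemma semantics_eqI:
  assumes "concl D' = concl D" "\<And>xs ys z. eval D' xs ys z \<longleftrightarrow> eval D xs ys z"
  shows "semantics D' = semantics D"
proof -
  obtain m n A r Ds r' Ds' where "D = Node (Seq m n A) r Ds" "D' = Node (Seq m n A) r' Ds'"
    using assms(1) by (metis coder.collapse sequent.exhaust)
  moreover from this have "eval (Node (Seq m n A) r' Ds') = eval (Node (Seq m n A) r Ds)"
    using assms(2) by (simp add: fun_eq_iff)
  ultimately show ?thesis
    by (simp only: semantics.simps)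
qed

text \<open>Members of \<open>Rns\<close> have no value on lists of wrong lengths, so their initial
  sequents respect arities too.\<close>

lemma coderivation_Rns_eval_fits:
  "eval D xs ys z \<Longrightarrow> coderivation Rns D \<Longrightarrow> fits xs ys (concl D)"
  by (induction rule: eval.induct)
    (auto simp: coderivation_Node Rns_def split: if_splits elim!: inference_cases)

text \<open>The converse of \<open>eval_prune\<close> needs no second induction: a value of
  \<open>prune E\<close> forces the arguments to fit, totality gives \<open>E\<close> a value there,
  \<open>eval_prune\<close> transports it, and determinism identifies the two.\<close>

lemma eval_prune_iff:
  assumes "coderivation {} E" "progressing E"
  shows "eval (prune E) xs ys z \<longleftrightarrow> eval E xs ys z"
proof
  assume z: "eval (prune E) xs ys z"
  then have "fits xs ys (concl E)"
    using coderivation_Rns_eval_fits coderivation_prune assms by (metis concl_prune)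
  then obtain w where w: "eval E xs ys w"
    using progressing_computes assms unfolding computes_def by blast
  then have "z = w"
    using eval_prune eval_deterministic assms z by blast
  then show "eval E xs ys z"
    using w by simp
qed (use eval_prune assms in blast)

text \<open>Pruning stops at the root or at a premise of a kept node, and \<open>K\<close> collects
  these candidates. It is finite when the kept nodes are, as each has finitely many premises. Adding
  \<open>collapse E\<close> for every \<open>E\<close> in \<open>K\<close> is harmless, since each
  collapse is finite.\<close>

lemma subcoders_prune:
  defines "K \<equiv> \<lambda>D. insert D (\<Union>E\<in>{E \<in> subcoders D. \<not> length_coder E}. set (prems E))"
  shows "subcoders (prune D) \<subseteq> (\<Union>E\<in>K D. insert (prune E) (subcoders (collapse E)))"
proof
  fix X
  assume "X \<in> subcoders (prune D)"
  then have "\<exists>E \<in> K D. X = prune E \<or> length_coder E \<and> X \<in> subcoders (collapse E)"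
  proof induction
    case 1
    then show ?case by (auto simp: K_def)
  next
    case (2 X X')
    then obtain E where E: "E \<in> K D" "X = prune E \<or> length_coder E \<and> X \<in> subcoders (collapse E)"
      by blast
    show ?case
    proof (cases "length_coder E")
      case True
      then have "X \<in> subcoders (collapse E)"
        using E by (auto simp: prune_length_coder intro: subcoders.intros)
      then show ?thesis
        using E(1) True 2(2) by (blast intro: subcoders.intros)
    next
      case False
      then obtain E' where "E' \<in> set (prems E)" "X' = prune E'"
        using E 2(2) by (auto simp: prune_other)
      moreover have "E \<in> subcoders D"
        using E(1) by (auto simp: K_def intro: subcoders.intros)
      ultimately show ?thesis
        using False by (auto simp: K_def)
    qed
  qed
  then show "X \<in> (\<Union>E\<in>K D. insert (prune E) (subcoders (collapse E)))"
    by blast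
qed

lemma regular_prune:
  assumes "rule_regular {CondB, CondN, S0, S1, Id} D"
  shows "regular (prune D)"
proof -
  have "finite {E \<in> subcoders D. \<not> length_coder E}"
    using assms by (simp add: rule_regular_def length_coder_def)
  then show ?thesis
    unfolding regular_def by (intro finite_subset[OF subcoders_prune]) (simp add: finite_subcoders_collapse)
qed

text \<open>Following the same choices \<open>d\<close> in \<open>D\<close> yields \<open>e\<close>.
  From \<open>b i\<close> on, the branch is an infinite branch of \<open>b i\<close>, so
  \<open>b i\<close> is no collapse but a copy of \<open>e i\<close>, with the same sequent and
  rule.\<close>

lemma branch_prune:
  assumes "branch (prune D) b d"
  obtains e where "branch D e d" "\<And>i. concl (b i) = concl (e i)" "\<And>i. last_rule (b i) = last_rule (e i)"
proof -
  define e where "e = rec_nat D (\<lambda>i E. prems E ! d i)"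
  have branch_suffix: "branch (b i) (\<lambda>j. b (i + j)) (\<lambda>j. d (i + j))" for i
    using assms by (simp add: branch_def)
  have b: "b i = prune (e i)" "\<not> length_coder (e i)" for i
  proof (induction i)
    case 0
    show "b 0 = prune (e 0)"
      using assms by (simp add: branch_def e_def)
    then show "\<not> length_coder (e 0)"
      using branch_suffix[of 0] no_branch_collapse by (auto simp: prune_length_coder)
  next
    case (Suc i)
    have "d i < length (prems (b i))" "b (Suc i) = prems (b i) ! d i"
      using assms by (auto simp: branch_def)
    then show "b (Suc i) = prune (e (Suc i))"
      using Suc by (simp add: prune_other e_def)
    then show "\<not> length_coder (e (Suc i))"
      using branch_suffix[of "Suc i"] no_branch_collapse by (metis prune_length_coder)
  qed
  show ?thesis
  proof
    show "branch D e d"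
      using assms b by (auto simp: branch_def e_def prune_other)
    show "concl (b i) = concl (e i)" "last_rule (b i) = last_rule (e i)" for i
      using b by (simp_all add: prune_other)
  qed
qed

section \<open>Transfer of the criteria on branches\<close>

lemma progressing_prune: "progressing D \<Longrightarrow> progressing (prune D)"
  unfolding progressing_def
proof (intro allI impI)
  fix b d
  assume D: "\<forall>b d. branch D b d \<longrightarrow> (\<exists>s t. thread b d s t \<and> progressing_thread b s t)"
    and "branch (prune D) b d"
  then obtain e where e: "branch D e d" "\<And>i. concl (b i) = concl (e i)"
    "\<And>i. last_rule (b i) = last_rule (e i)"
    using branch_prune by blast
  then show "\<exists>s t. thread b d s t \<and> progressing_thread b s t"
    using D unfolding thread_def progressing_thread_def by simp
qed

lemma safe_coder_prune: "safe_coder D \<Longrightarrow> safe_coder (prune D)"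
  unfolding safe_coder_def by (metis (no_types, lifting) branch_prune Collect_cong)

lemma left_leaning_prune: "left_leaning D \<Longrightarrow> left_leaning (prune D)"
  unfolding left_leaning_def by (metis (no_types, lifting) branch_prune Collect_cong)

theorem mainTheorem9:
  fixes D :: coder
  assumes "D \<in> nuB"
  shows "\<exists>D' \<in> CB Rns. semantics D' = semantics D"
proof
  have D: "coderivation {} D" "rule_regular {CondB, CondN, S0, S1, Id} D" "progressing D"
      "safe_coder D" "left_leaning D"
    using assms by (auto simp: nuB_def)
  then show "prune D \<in> CB Rns"
    by (simp add: CB_def coderivation_prune regular_prune progressing_prune safe_coder_prune
        left_leaning_prune)
  show "semantics (prune D) = semantics D"
    using D by (intro semantics_eqI) (simp_all add: eval_prune_iff)
qed

end
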